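(* Let $N$ be the five-dimensional Heisenberg group with Lie algebra $\mathcal N$ (elements regarded as left invariant vector fields on $N$) and center $\mathcal Z$. Let $\langle\cdot,\cdot\rangle$ be any Euclidean scalar product on $\mathcal N$, let $Z\in\mathcal Z$ be such that $\mathcal Z=\operatorname{span} Z$ and $\langle Z,Z\rangle=1$, let $0<\xi<1$ be a real number, and put $X_0=\xi Z$. Let $F$ be the left invariant $Z$-Randers metric on $N$ obtained by left translations from the Minkowski functional $$f\colon\mathcal N\to\mathbf R,\qquad f(X)=\sqrt{\langle X,X\rangle}+\langle X_0,X\rangle .$$ Then there exist flags $\sigma(W,X)$ whose flag curvature with respect to $F$ satisfies $K(W,X)<0$, and there exist flags $\sigma(W,X)$ whose flag curvature with respect to $F$ satisfies $K(W,X)>0$.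
   Context: The five-dimensional Heisenberg group $N$ is the (up to isomorphism unique) simply connected two-step nilpotent Lie group of dimension five with one-dimensional center; $\mathcal N$ is its real Lie algebra. A left invariant $Z$-Randers metric is a left invariant Randers type Finsler metric $F$ on $N$ whose restriction to $\mathcal N\cong T_eN$ is $f(X)=\sqrt{\langle X,X\rangle}+\langle X_0,X\rangle$, where the deformation vector $X_0=\xi Z$, $0<\xi<1$, lies in the center and $Z$ is a $\langle\cdot,\cdot\rangle$-unit vector spanning the center. For a nonzero vector $W$ the osculating scalar product is $$\langle U,V\rangle_W=\frac12\frac{\partial^2}{\partial s\,\partial t}\bigg|_{s=t=0}F^2(W+sU+tV),$$ with $\|U\|_W^2=\langle U,U\rangle_W$, and the $(0,3)$-type Cartan tensor is $$\langle U,V,Y\rangle_W=\frac14\frac{\partial^3}{\partial r\,\partial s\,\partial t}\bigg|_{r=s=t=0}F^2(W+rU+sV+tY).$$ For a nowhere vanishing vector field $W$ on $N$, the Chern–Rund connection $\nabla^W\colon\mathfrak X(N)\times\mathfrak X(N)\to\mathfrak X(N)$ is the affine connection that is torsion free and almost metric, i.e. $$X\langle Y,V\rangle_W=\langle\nabla^W_XY,V\rangle_W+\langle Y,\nabla^W_XV\rangle_W+2\langle\nabla^W_XW,Y,V\rangle_W .$$ It is determined by the generalized Koszul formula $$2\langle\nabla^W_XY,V\rangle_W=X\langle Y,V\rangle_W+Y\langle V,X\rangle_W-V\langle X,Y\rangle_W+\langle[X,Y],V\rangle_W-\langle[Y,V],X\rangle_W+\langle[V,X],Y\rangle_W$$ $$\qquad-2\langle\nabla^W_XW,Y,V\rangle_W-2\langle\nabla^W_YW,V,X\rangle_W+2\langle\nabla^W_VW,X,Y\rangle_W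 .$$ For left invariant vector fields $W,X,Y,V$ the first three terms on the right hand side vanish. The curvature of $\nabla^W$ is $$R^W(X,Y)V=\nabla^W_X\nabla^W_YV-\nabla^W_Y\nabla^W_XV-\nabla^W_{[X,Y]}V.$$ A flag $\sigma(W,X)$ consists of a nonzero vector $W$ (the flag pole) and the two-dimensional subspace spanned by $W$ and a vector $X$ transverse to it (i.e. $W,X$ linearly independent). Its flag curvature is $$K(\sigma(W,X))=K(W,X)=\frac{\langle R^W(X,W)W,X\rangle_W}{\|W\|_W^2\,\|X\|_W^2-\langle X,W\rangle_W^2},$$ where vectors $W,X\in\mathcal N$ are regarded as left invariant vector fields on $N$. *)

theory Defs
  imports "HOL-Analysis.Analysis"
begin

section \<open>The Heisenberg algebra and the Heisenberg group\<close>

definition lie_bracket :: "('a::real_vector \<Rightarrow> 'a \<Rightarrow> 'a) \<Rightarrow> bool" where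
  "lie_bracket br \<longleftrightarrow>
     (\<forall>x. linear (br x)) \<and> (\<forall>y. linear (\<lambda>x. br x y)) \<and>
     (\<forall>x. br x x = 0) \<and>
     (\<forall>x y z. br x (br y z) + br y (br z x) + br z (br x y) = 0)"

definition lie_center :: "('a::real_vector \<Rightarrow> 'a \<Rightarrow> 'a) \<Rightarrow> 'a set" where
  "lie_center br = {z. \<forall>x. br z x = 0}"

definition two_step_nilpotent :: "('a::real_vector \<Rightarrow> 'a \<Rightarrow> 'a) \<Rightarrow> bool" where
  "two_step_nilpotent br \<longleftrightarrow>
     (\<exists>x y. br x y \<noteq> 0) \<and> (\<forall>x y z. br (br x y) z = 0)"

definition heisenberg_algebra5 :: "('a::euclidean_space \<Rightarrow> 'a \<Rightarrow> 'a) \<Rightarrow> bool" where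
  "heisenberg_algebra5 br \<longleftrightarrow>
     DIM('a) = 5 \<and> lie_bracket br \<and> two_step_nilpotent br \<and> dim (lie_center br) = 1"

text \<open>The simply connected group of a two-step nilpotent Lie algebra, in exponential
  coordinates: the underlying manifold is the Lie algebra itself, and the product is given by the
  Baker-Campbell-Hausdorff formula, which stops after the first bracket.  The neutral element
  is \<open>0\<close> and the inverse of \<open>p\<close> is \<open>- p\<close>.  All tangent spaces are identified with \<open>'a\<close> through
  this global chart.\<close>

definition group_mult :: "('a::real_vector \<Rightarrow> 'a \<Rightarrow> 'a) \<Rightarrow> 'a \<Rightarrow> 'a \<Rightarrow> 'a" where
  "group_mult br p q = p + q + (1/2) *\<^sub>R br p q"

lemma group_mult_laws:
  assumes "lie_bracket br" and "two_step_nilpotent br"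
  shows "group_mult br (group_mult br p q) r = group_mult br p (group_mult br q r)"
    and "group_mult br 0 p = p" and "group_mult br p 0 = p"
    and "group_mult br p (- p) = 0" and "group_mult br (- p) p = 0"
proof -
  have lin: "\<And>x. linear (br x)" "\<And>y. linear (\<lambda>x. br x y)" and alt: "\<And>x. br x x = 0"
    using assms(1) by (auto simp: lie_bracket_def)
  have nil: "\<And>x y z. br (br x y) z = 0"
    using assms(2) by (auto simp: two_step_nilpotent_def)
  note simps = linear_add[OF lin(1)] linear_add[OF lin(2)] linear_cmul[OF lin(1)]
    linear_cmul[OF lin(2)] linear_neg[OF lin(1)] linear_neg[OF lin(2)]
    linear_0[OF lin(1)] linear_0[OF lin(2)]
  have skew: "br x y = - br y x" for x y
  proof -
    have "br (x + y) (x + y) = br x y + br y x"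
      by (simp only: simps) (simp add: alt)
    then show ?thesis
      by (simp add: alt eq_neg_iff_add_eq_0)
  qed
  have nil': "br z (br x y) = 0" for x y z
    by (subst skew) (simp add: nil)
  show "group_mult br (group_mult br p q) r = group_mult br p (group_mult br q r)"
    by (simp add: group_mult_def simps nil nil' algebra_simps)
  show "group_mult br 0 p = p" "group_mult br p 0 = p"
    "group_mult br p (- p) = 0" "group_mult br (- p) p = 0"
    by (simp_all add: group_mult_def simps alt)
qed

section \<open>Vector fields\<close>

primrec C_k :: "nat \<Rightarrow> ('a::real_normed_vector \<Rightarrow> 'b::real_normed_vector) \<Rightarrow> bool" where
  "C_k 0 g \<longleftrightarrow> continuous_on UNIV g"
| "C_k (Suc k) g \<longleftrightarrow>
     g differentiable_on UNIV \<and> (\<forall>v. C_k k (\<lambda>p. frechet_derivative g (at p) v))"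

definition smooth :: "('a::real_normed_vector \<Rightarrow> 'b::real_normed_vector) \<Rightarrow> bool" where
  "smooth g \<longleftrightarrow> (\<forall>k. C_k k g)"

definition field_deriv ::
  "('a::real_normed_vector \<Rightarrow> 'a) \<Rightarrow> ('a \<Rightarrow> 'b::real_normed_vector) \<Rightarrow> 'a \<Rightarrow> 'b" where
  "field_deriv X g p = frechet_derivative g (at p) (X p)"

definition field_bracket ::
  "('a::real_normed_vector \<Rightarrow> 'a) \<Rightarrow> ('a \<Rightarrow> 'a) \<Rightarrow> 'a \<Rightarrow> 'a" where
  "field_bracket X Y p = field_deriv X Y p - field_deriv Y X p"

definition left_field ::
  "('a::real_normed_vector \<Rightarrow> 'a \<Rightarrow> 'a) \<Rightarrow> 'a \<Rightarrow> 'a \<Rightarrow> 'a" where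
  "left_field br X p = frechet_derivative (group_mult br p) (at 0) X"

lemma left_field_eq:
  fixes br :: "'a::euclidean_space \<Rightarrow> 'a \<Rightarrow> 'a"
  assumes "lie_bracket br"
  shows "left_field br X p = X + (1/2) *\<^sub>R br p X"
proof -
  have "linear (br p)"
    using assms by (simp add: lie_bracket_def)
  then have "bounded_linear (br p)"
    by (simp add: linear_conv_bounded_linear)
  then have "(br p has_derivative br p) (at 0)"
    by (rule bounded_linear_imp_has_derivative)
  then have "(group_mult br p has_derivative (\<lambda>h. h + (1/2) *\<^sub>R br p h)) (at 0)"
    unfolding group_mult_def by (auto intro!: derivative_eq_intros)
  then show ?thesis
    unfolding left_field_def by (simp add: frechet_derivative_at[symmetric])
qed

text \<open>The Lie algebra of left invariant vector fields is the one we started from.\<close>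

lemma field_bracket_left_field:
  fixes br :: "'a::euclidean_space \<Rightarrow> 'a \<Rightarrow> 'a"
  assumes "lie_bracket br" and "two_step_nilpotent br"
  shows "field_bracket (left_field br X) (left_field br Y) = left_field br (br X Y)"
proof
  fix p
  have lin: "\<And>x. linear (br x)" "\<And>y. linear (\<lambda>x. br x y)" and alt: "\<And>x. br x x = 0"
    using assms(1) by (auto simp: lie_bracket_def)
  have nil: "\<And>x y z. br (br x y) z = 0"
    using assms(2) by (auto simp: two_step_nilpotent_def)
  note simps = linear_add[OF lin(1)] linear_add[OF lin(2)] linear_cmul[OF lin(1)]
    linear_cmul[OF lin(2)] linear_0[OF lin(1)] linear_0[OF lin(2)]
  have skew: "br x y = - br y x" for x y
  proof -
    have "br (x + y) (x + y) = br x y + br y x"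
      by (simp only: simps) (simp add: alt)
    then show ?thesis
      by (simp add: alt eq_neg_iff_add_eq_0)
  qed
  have nil': "br z (br x y) = 0" for x y z
    by (subst skew) (simp add: nil)
  have D: "frechet_derivative (left_field br V) (at p) = (\<lambda>h. (1/2) *\<^sub>R br h V)" for V
  proof -
    have "bounded_linear (\<lambda>x. br x V)"
      using lin(2) by (simp add: linear_conv_bounded_linear)
    then have "((\<lambda>x. br x V) has_derivative (\<lambda>x. br x V)) (at p)"
      by (rule bounded_linear_imp_has_derivative)
    then have "((\<lambda>x. V + (1/2) *\<^sub>R br x V) has_derivative (\<lambda>h. (1/2) *\<^sub>R br h V)) (at p)"
      by (auto intro!: derivative_eq_intros)
    moreover have "left_field br V = (\<lambda>x. V + (1/2) *\<^sub>R br x V)"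
      by (auto simp: left_field_eq[OF assms(1)])
    ultimately show ?thesis
      by (simp add: frechet_derivative_at[symmetric])
  qed
  have "(1/2) *\<^sub>R br X Y - (1/2) *\<^sub>R br Y X = br X Y"
    by (subst (2) skew) (simp flip: scaleR_add_left)
  then show "field_bracket (left_field br X) (left_field br Y) p = left_field br (br X Y) p"
    by (simp add: field_bracket_def field_deriv_def D left_field_eq[OF assms(1)] simps nil nil')
qed

section \<open>Left invariant Randers metrics\<close>

definition euclidean_scalar_product :: "('a::real_vector \<Rightarrow> 'a \<Rightarrow> real) \<Rightarrow> bool" where
  "euclidean_scalar_product ip \<longleftrightarrow>
     (\<forall>x. linear (ip x)) \<and> (\<forall>x y. ip x y = ip y x) \<and> (\<forall>x. x \<noteq> 0 \<longrightarrow> ip x x > 0)"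

definition randers_functional ::
  "('a::real_vector \<Rightarrow> 'a \<Rightarrow> real) \<Rightarrow> 'a \<Rightarrow> 'a \<Rightarrow> real" where
  "randers_functional ip X0 X = sqrt (ip X X) + ip X0 X"

text \<open>A Finsler function is written \<open>F p v\<close> with \<open>p\<close> a point and \<open>v\<close> a tangent vector at \<open>p\<close>.
  The left invariant one takes \<open>v\<close> back to the neutral element by the translation by \<open>- p\<close>, the
  inverse of \<open>p\<close>.\<close>

definition left_invariant_metric ::
  "('a::real_normed_vector \<Rightarrow> 'a \<Rightarrow> 'a) \<Rightarrow> ('a \<Rightarrow> real) \<Rightarrow> 'a \<Rightarrow> 'a \<Rightarrow> real" where
  "left_invariant_metric br f p v = f (frechet_derivative (group_mult br (- p)) (at p) v)"

section \<open>Osculating scalar product, Cartan tensor, Chern-Rund connection\<close>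

definition osc ::
  "('a::real_vector \<Rightarrow> 'a \<Rightarrow> real) \<Rightarrow> 'a \<Rightarrow> 'a \<Rightarrow> 'a \<Rightarrow> 'a \<Rightarrow> real" where
  "osc F p w u v =
     1/2 * deriv (\<lambda>s. deriv (\<lambda>t. (F p (w + s *\<^sub>R u + t *\<^sub>R v))\<^sup>2) 0) 0"

definition cartan ::
  "('a::real_vector \<Rightarrow> 'a \<Rightarrow> real) \<Rightarrow> 'a \<Rightarrow> 'a \<Rightarrow> 'a \<Rightarrow> 'a \<Rightarrow> 'a \<Rightarrow> real" where
  "cartan F p w u v y =
     1/4 * deriv (\<lambda>r. deriv (\<lambda>s. deriv (\<lambda>t.
        (F p (w + r *\<^sub>R u + s *\<^sub>R v + t *\<^sub>R y))\<^sup>2) 0) 0) 0"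

definition affine_connection ::
  "(('a::real_normed_vector \<Rightarrow> 'a) \<Rightarrow> ('a \<Rightarrow> 'a) \<Rightarrow> ('a \<Rightarrow> 'a)) \<Rightarrow> bool" where
  "affine_connection nab \<longleftrightarrow>
     (\<forall>X Y. smooth X \<longrightarrow> smooth Y \<longrightarrow> smooth (nab X Y)) \<and>
     (\<forall>X X' Y. smooth X \<longrightarrow> smooth X' \<longrightarrow> smooth Y \<longrightarrow>
        nab (\<lambda>p. X p + X' p) Y = (\<lambda>p. nab X Y p + nab X' Y p)) \<and>
     (\<forall>(h::'a \<Rightarrow> real) X Y. smooth h \<longrightarrow> smooth X \<longrightarrow> smooth Y \<longrightarrow>
        nab (\<lambda>p. h p *\<^sub>R X p) Y = (\<lambda>p. h p *\<^sub>R nab X Y p)) \<and>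
     (\<forall>X Y Y'. smooth X \<longrightarrow> smooth Y \<longrightarrow> smooth Y' \<longrightarrow>
        nab X (\<lambda>p. Y p + Y' p) = (\<lambda>p. nab X Y p + nab X Y' p)) \<and>
     (\<forall>(h::'a \<Rightarrow> real) X Y. smooth h \<longrightarrow> smooth X \<longrightarrow> smooth Y \<longrightarrow>
        nab X (\<lambda>p. h p *\<^sub>R Y p) = (\<lambda>p. field_deriv X h p *\<^sub>R Y p + h p *\<^sub>R nab X Y p))"

definition torsion_free ::
  "(('a::real_normed_vector \<Rightarrow> 'a) \<Rightarrow> ('a \<Rightarrow> 'a) \<Rightarrow> ('a \<Rightarrow> 'a)) \<Rightarrow> bool" where
  "torsion_free nab \<longleftrightarrow>
     (\<forall>X Y. smooth X \<longrightarrow> smooth Y \<longrightarrow>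
        (\<lambda>p. nab X Y p - nab Y X p) = field_bracket X Y)"

definition almost_metric ::
  "('a::real_normed_vector \<Rightarrow> 'a \<Rightarrow> real) \<Rightarrow> ('a \<Rightarrow> 'a) \<Rightarrow>
   (('a \<Rightarrow> 'a) \<Rightarrow> ('a \<Rightarrow> 'a) \<Rightarrow> ('a \<Rightarrow> 'a)) \<Rightarrow> bool" where
  "almost_metric F W nab \<longleftrightarrow>
     (\<forall>X Y V p. smooth X \<longrightarrow> smooth Y \<longrightarrow> smooth V \<longrightarrow>
        field_deriv X (\<lambda>q. osc F q (W q) (Y q) (V q)) p =
          osc F p (W p) (nab X Y p) (V p) + osc F p (W p) (Y p) (nab X V p)
          + 2 * cartan F p (W p) (nab X W p) (Y p) (V p))"

definition is_chern_rund ::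
  "('a::real_normed_vector \<Rightarrow> 'a \<Rightarrow> real) \<Rightarrow> ('a \<Rightarrow> 'a) \<Rightarrow>
   (('a \<Rightarrow> 'a) \<Rightarrow> ('a \<Rightarrow> 'a) \<Rightarrow> ('a \<Rightarrow> 'a)) \<Rightarrow> bool" where
  "is_chern_rund F W nab \<longleftrightarrow>
     affine_connection nab \<and> torsion_free nab \<and> almost_metric F W nab"

text \<open>\<open>SOME\<close> rather than \<open>THE\<close>, because the connection is unique only on smooth vector fields
  and HOL functions also take values elsewhere.\<close>

definition chern_rund ::
  "('a::real_normed_vector \<Rightarrow> 'a \<Rightarrow> real) \<Rightarrow> ('a \<Rightarrow> 'a) \<Rightarrow>
   ('a \<Rightarrow> 'a) \<Rightarrow> ('a \<Rightarrow> 'a) \<Rightarrow> ('a \<Rightarrow> 'a)" where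
  "chern_rund F W = (SOME nab. is_chern_rund F W nab)"

definition curvature ::
  "(('a::real_normed_vector \<Rightarrow> 'a) \<Rightarrow> ('a \<Rightarrow> 'a) \<Rightarrow> ('a \<Rightarrow> 'a)) \<Rightarrow>
   ('a \<Rightarrow> 'a) \<Rightarrow> ('a \<Rightarrow> 'a) \<Rightarrow> ('a \<Rightarrow> 'a) \<Rightarrow> ('a \<Rightarrow> 'a)" where
  "curvature nab X Y V =
     (\<lambda>p. nab X (nab Y V) p - nab Y (nab X V) p - nab (field_bracket X Y) V p)"

section \<open>Flags and flag curvature\<close>

definition is_flag :: "'a::real_vector \<Rightarrow> 'a \<Rightarrow> bool" where
  "is_flag W X \<longleftrightarrow> W \<noteq> X \<and> independent {W, X}"

text \<open>The vectors \<open>W\<close>, \<open>X\<close> are extended to left invariant vector fields, and the resulting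
  expression, which is constant on the group, is evaluated at the neutral element \<open>0\<close>.\<close>

definition flag_curvature ::
  "('a::real_normed_vector \<Rightarrow> 'a \<Rightarrow> 'a) \<Rightarrow> ('a \<Rightarrow> 'a \<Rightarrow> real) \<Rightarrow> 'a \<Rightarrow> 'a \<Rightarrow> real" where
  "flag_curvature br F W X =
     (let W' = left_field br W; X' = left_field br X;
          R = curvature (chern_rund F W')
      in osc F 0 W (R X' W' W' 0) X /
         (osc F 0 W W W * osc F 0 W X X - (osc F 0 W X W)\<^sup>2))"

end

theory Submission
  imports Defs
begin

text \<open>Left translation identifies vector fields on the group with maps into the Lie algebra, and a
  left invariant field with a constant map.  Along a left invariant \<open>W\<close>, the osculating product
  and the Cartan tensor therefore have constant coefficients \<open>g\<close> and \<open>C\<close>, and the generalized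
  Koszul formula turns the Chern-Rund connection into an algebraic product \<open>n x y\<close> on the Lie
  algebra (\<open>christoffel\<close>).  It is solved in three stages, first for \<open>n w w\<close>, next for
  \<open>n x w\<close>, then for all \<open>n x y\<close>, since each stage needs only values of the one before.  Both
  existence and uniqueness matter: the connection is a Hilbert choice, so nothing is known about it
  before some connection is exhibited on all smooth fields (\<open>is_chern_rund_connection\<close>), and its
  values on left invariant fields are then forced (\<open>chern_rund_left_field\<close>).  Torsion
  freeness and almost metricity eliminate all products but \<open>A x = n x w\<close> from the flag curvature
  (\<open>flag_curvature_left_field\<close>).

  Two kinds of flags decide the signs.  Write \<open>[u, v] = \<kappa> u v Z\<close> and \<open>\<kappa> u v = \<langle>J u, v\<rangle>\<close>.

  If the pole is \<open>Z\<close>, the Cartan tensor vanishes and \<open>n Z Z = 0\<close>, so that the numerator for a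
  transverse horizontal vector \<open>e\<close> is \<open>g (A e) (A e)\<close>; this is positive unless \<open>e\<close> is central
  (\<open>flag_curvature_center_pos\<close>).

  If \<open>e\<close> and \<open>f\<close> are orthonormal and horizontal, and \<open>c = \<kappa> e f\<close>, then \<open>A e = - \<xi> J e\<close> and
  \<open>A f = - (c Z + \<xi> J f) / 2\<close>, and the flag curvature with pole \<open>e\<close> is
  \<open>- 3/4 c\<^sup>2 + \<xi>\<^sup>2 / 4 (c\<^sup>2 + |J f|\<^sup>2 - |J e|\<^sup>2)\<close>.  For \<open>\<xi> = 0\<close> this is the classical Riemannian value.
  The last difference is the only part of unknown sign, and it changes sign when \<open>e\<close> and \<open>f\<close>
  are exchanged while \<open>c\<^sup>2\<close> stays; so one of the two orders gives at most
  \<open>(\<xi>\<^sup>2 - 3) c\<^sup>2 / 4\<close>, which is negative if \<open>e\<close> and \<open>f\<close> do not commute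
  (\<open>flag_curvature_horizontal_neg\<close>).\<close>

section \<open>Smooth maps\<close>

lemma C_k_Suc_imp: "C_k (Suc k) f \<Longrightarrow> C_k k f"
  by (induction k arbitrary: f) (auto intro: differentiable_imp_continuous_on)

lemma C_k_const: "C_k k (\<lambda>p. c)"
  by (induction k arbitrary: c) (auto simp: frechet_derivative_const)

lemma C_k_ident: "C_k k (\<lambda>p. p)"
  by (cases k) (auto simp: C_k_const differentiable_on_def)

lemma C_k_add:
  "C_k k f \<Longrightarrow> C_k k g \<Longrightarrow> C_k k (\<lambda>p. f p + g p)"
proof (induction k arbitrary: f g)
  case 0
  then show ?case by (auto intro: continuous_intros)
next
  case (Suc k)
  then have d: "f differentiable at p" "g differentiable at p" for p
    by (auto simp: differentiable_on_def)
  have "frechet_derivative (\<lambda>p. f p + g p) (at p) =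
      (\<lambda>v. frechet_derivative f (at p) v + frechet_derivative g (at p) v)" for p
    by (rule frechet_derivative_at[symmetric], intro has_derivative_add)
      (use d frechet_derivative_works in blast)+
  then show ?case
    using Suc d by (auto simp: differentiable_on_def)
qed

text \<open>The product rule expresses a derivative by products of the factors and their derivatives.  The
  undifferentiated factors must be known to be \<open>C_k k\<close> as well, which is what
  \<open>C_k_Suc_imp\<close> provides.\<close>

lemma C_k_bilinear:
  assumes "bounded_bilinear B"
  shows "C_k k f \<Longrightarrow> C_k k g \<Longrightarrow> C_k k (\<lambda>p. B (f p) (g p))"
proof (induction k arbitrary: f g)
  case 0
  then show ?case using assms by (auto intro: bounded_bilinear.continuous_on)
next
  case (Suc k)
  then have d: "f differentiable at p" "g differentiable at p" for p
    by (auto simp: differentiable_on_def)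
  have D: "((\<lambda>p. B (f p) (g p)) has_derivative
      (\<lambda>v. B (f p) (frechet_derivative g (at p) v) + B (frechet_derivative f (at p) v) (g p))) (at p)" for p
    by (rule bounded_bilinear.FDERIV[OF assms]) (use d frechet_derivative_works in blast)+
  have lower: "C_k k f" "C_k k g"
    using Suc.prems C_k_Suc_imp by blast+
  have "C_k k (\<lambda>p. frechet_derivative (\<lambda>p. B (f p) (g p)) (at p) v)" for v
    unfolding frechet_derivative_at[OF D, symmetric]
    using Suc.prems lower by (intro C_k_add Suc.IH) auto
  then show ?case
    using D by (auto simp: differentiable_on_def differentiable_def)
qed

lemma smooth_const: "smooth (\<lambda>p. c)"
  and smooth_ident: "smooth (\<lambda>p. p)"
  by (simp_all add: smooth_def C_k_const C_k_ident)

lemma smooth_add: "smooth f \<Longrightarrow> smooth g \<Longrightarrow> smooth (\<lambda>p. f p + g p)"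
  by (simp add: smooth_def C_k_add)

lemma smooth_bilinear:
  "bounded_bilinear B \<Longrightarrow> smooth f \<Longrightarrow> smooth g \<Longrightarrow> smooth (\<lambda>p. B (f p) (g p))"
  by (simp add: smooth_def C_k_bilinear)

lemma smooth_scaleR: "smooth f \<Longrightarrow> smooth g \<Longrightarrow> smooth (\<lambda>p. f p *\<^sub>R g p)"
  by (rule smooth_bilinear[OF bounded_bilinear_scaleR])

lemma smooth_sum: "(\<And>i. i \<in> I \<Longrightarrow> smooth (f i)) \<Longrightarrow> smooth (\<lambda>p. \<Sum>i\<in>I. f i p)"
  by (induction I rule: infinite_finite_induct) (auto intro: smooth_const smooth_add)

lemma smooth_has_derivative:
  assumes "smooth f"
  shows "(f has_derivative frechet_derivative f (at p)) (at p)"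
proof -
  have "C_k (Suc 0) f" using assms by (simp only: smooth_def)
  then show ?thesis
    by (simp add: differentiable_on_def frechet_derivative_works)
qed

lemma smooth_frechet_derivative:
  assumes "smooth f"
  shows "smooth (\<lambda>p. frechet_derivative f (at p) v)"
  unfolding smooth_def
proof
  fix k
  have "C_k (Suc k) f" using assms by (simp only: smooth_def)
  then show "C_k k (\<lambda>p. frechet_derivative f (at p) v)" by simp
qed

text \<open>Smoothness speaks of derivatives in constant directions only, so a variable direction is
  expanded in the basis, with smooth coefficients.\<close>

lemma smooth_field_deriv:
  fixes f :: "'a::euclidean_space \<Rightarrow> 'b::real_normed_vector"
  assumes f: "smooth f" and X: "smooth X"
  shows "smooth (\<lambda>p. frechet_derivative f (at p) (X p))"
proof -
  have "frechet_derivative f (at p) (X p) =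
      (\<Sum>b\<in>Basis. (X p \<bullet> b) *\<^sub>R frechet_derivative f (at p) b)" for p
  proof -
    have lin: "linear (frechet_derivative f (at p))"
      using smooth_has_derivative[OF f] has_derivative_linear by blast
    have "frechet_derivative f (at p) (X p) =
        frechet_derivative f (at p) (\<Sum>b\<in>Basis. (X p \<bullet> b) *\<^sub>R b)"
      by (simp add: euclidean_representation)
    then show ?thesis
      by (simp add: linear_sum[OF lin] linear_cmul[OF lin])
  qed
  moreover have "smooth (\<lambda>p. \<Sum>b\<in>Basis. (X p \<bullet> b) *\<^sub>R frechet_derivative f (at p) b)"
    by (intro smooth_sum smooth_scaleR smooth_bilinear[OF bounded_bilinear_inner]
        smooth_frechet_derivative f X smooth_const)
  ultimately show ?thesis by simp
qed

section \<open>Scalar products on a finite-dimensional space\<close>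

locale scalar_product =
  fixes B :: "'a::euclidean_space \<Rightarrow> 'a \<Rightarrow> real"
  assumes scalar_product: "euclidean_scalar_product B"
begin

lemma sym: "B x y = B y x"
  and pos: "x \<noteq> 0 \<Longrightarrow> B x x > 0"
  and linear_right: "linear (B x)"
  using scalar_product by (auto simp: euclidean_scalar_product_def)

lemma linear_left: "linear (\<lambda>x. B x y)"
  by (subst sym) (rule linear_right)

lemmas simps [simp] =
  linear_add[OF linear_right] linear_add[OF linear_left]
  linear_diff[OF linear_right] linear_diff[OF linear_left]
  linear_neg[OF linear_right] linear_neg[OF linear_left]
  linear_cmul[OF linear_right] linear_cmul[OF linear_left]
  linear_0[OF linear_right] linear_0[OF linear_left]

lemma self_eq_0_iff: "B x x = 0 \<longleftrightarrow> x = 0"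
  using pos[of x] by (cases "x = 0") auto

lemma eqI: "(\<And>v. B x v = B y v) \<Longrightarrow> x = y"
  using self_eq_0_iff[of "x - y"] by simp

lemma bounded_bilinear: "bounded_bilinear B"
  using linear_left linear_right by (simp add: bilinear_conv_bounded_bilinear[symmetric] bilinear_def)

text \<open>The coordinates of \<open>T u\<close> are the values \<open>B u b\<close> on the basis.  Definiteness makes the
  endomorphism \<open>T\<close> injective, hence surjective, so these values can be prescribed.\<close>

lemma riesz:
  assumes "linear \<phi>"
  obtains u where "\<And>v. B u v = \<phi> v"
proof -
  define T where "T u = (\<Sum>b\<in>Basis. B u b *\<^sub>R b)" for u
  have T_inner: "T u \<bullet> b = B u b" if "b \<in> Basis" for u b
    using that by (simp add: T_def)
  have lin: "linear T"
    by (rule linearI) (simp_all add: T_def scaleR_add_left sum.distrib scaleR_right.sum)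
  have eq_on: "B u v = \<psi> v" if "linear \<psi>" "\<And>b. b \<in> Basis \<Longrightarrow> B u b = \<psi> b" for u v \<psi>
    by (rule linear_eq_on[OF linear_right that(1), of v Basis]) (use that(2) in \<open>auto simp: span_Basis\<close>)
  have "inj T"
  proof (rule injI)
    fix x y assume "T x = T y"
    then have "B x b = B y b" if "b \<in> Basis" for b
      using T_inner[OF that] by metis
    then have "B x v = B y v" for v
      by (rule eq_on[OF linear_right])
    then show "x = y"
      by (rule eqI)
  qed
  then have "surj T"
    using lin linear_injective_imp_surjective by blast
  then obtain u where "T u = (\<Sum>b\<in>Basis. \<phi> b *\<^sub>R b)"
    by (metis surjD)
  then have "B u b = \<phi> b" if "b \<in> Basis" for b
    using T_inner[OF that, of u] that by simp
  then show thesis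
    using that eq_on[OF assms] by blast
qed

end

section \<open>Left trivialization\<close>

locale two_step_lie =
  fixes br :: "'a::euclidean_space \<Rightarrow> 'a \<Rightarrow> 'a"
  assumes lie: "lie_bracket br" and nilpotent: "two_step_nilpotent br"
begin

lemma br_linear_right: "linear (br x)"
  and br_linear_left: "linear (\<lambda>x. br x y)"
  and br_self [simp]: "br x x = 0"
  using lie by (auto simp: lie_bracket_def)

lemmas br_simps [simp] =
  linear_add[OF br_linear_right] linear_add[OF br_linear_left]
  linear_diff[OF br_linear_right] linear_diff[OF br_linear_left]
  linear_neg[OF br_linear_right] linear_neg[OF br_linear_left]
  linear_cmul[OF br_linear_right] linear_cmul[OF br_linear_left]
  linear_0[OF br_linear_right] linear_0[OF br_linear_left]

lemma br_skew: "br x y = - br y x"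
  using br_self[of "x + y"] by (simp del: br_self add: eq_neg_iff_add_eq_0) (simp add: add.commute)

lemma br_br_left [simp]: "br (br x y) z = 0"
  using nilpotent by (simp add: two_step_nilpotent_def)

lemma br_br_right [simp]: "br z (br x y) = 0"
  by (subst br_skew) simp

lemma br_bilinear: "bounded_bilinear br"
  using br_linear_left br_linear_right
  by (simp add: bilinear_conv_bounded_bilinear[symmetric] bilinear_def)

text \<open>This is the pullback of \<open>Y\<close> to the Lie algebra by left translation: since brackets of brackets
  vanish, \<open>v - 1/2 [p, v]\<close> inverts \<open>v + 1/2 [p, v]\<close>.\<close>

definition triv :: "('a \<Rightarrow> 'a) \<Rightarrow> 'a \<Rightarrow> 'a" where
  "triv Y p = Y p - (1/2) *\<^sub>R br p (Y p)"

lemma left_field: "left_field br v p = v + (1/2) *\<^sub>R br p v"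
  by (rule left_field_eq[OF lie])

lemma triv_left_field [simp]: "triv (left_field br v) = (\<lambda>p. v)"
  by (auto simp: triv_def left_field)

lemma left_field_triv [simp]: "left_field br (triv Y p) p = Y p"
  by (simp add: triv_def left_field)

lemma left_field_add: "left_field br (u + v) p = left_field br u p + left_field br v p"
  and left_field_diff: "left_field br (u - v) p = left_field br u p - left_field br v p"
  and left_field_scaleR: "left_field br (c *\<^sub>R v) p = c *\<^sub>R left_field br v p"
  by (simp_all add: left_field algebra_simps)

lemma smooth_triv: "smooth Y \<Longrightarrow> smooth (triv Y)"
  using smooth_add[OF _ smooth_scaleR[OF smooth_const smooth_bilinear[OF br_bilinear smooth_ident]],
      of Y Y "- 1/2"]
  by (simp add: triv_def[abs_def])

lemma smooth_left_field: "smooth y \<Longrightarrow> smooth (\<lambda>p. left_field br (y p) p)"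
  unfolding left_field
  by (intro smooth_add smooth_scaleR smooth_const smooth_bilinear[OF br_bilinear] smooth_ident)

lemma smooth_left_invariant: "smooth (left_field br v)"
  by (rule smooth_left_field[OF smooth_const])

text \<open>Half of the bracket appears because the field \<open>v + 1/2 [p, v]\<close> is not constant in the
  chart.  Antisymmetrizing in the two fields yields a full bracket, which the algebraic part of the
  connection has to compensate for the torsion to vanish.\<close>

lemma left_field_deriv_triv:
  assumes "smooth Y"
  shows "left_field br (frechet_derivative (triv Y) (at p) h) p =
    frechet_derivative Y (at p) h - (1/2) *\<^sub>R br h (Y p)"
proof -
  have "(triv Y has_derivative (\<lambda>h. frechet_derivative Y (at p) h -
      (1/2) *\<^sub>R (br p (frechet_derivative Y (at p) h) + br h (Y p)))) (at p)"
    unfolding triv_def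
    by (intro has_derivative_diff has_derivative_scaleR_right smooth_has_derivative assms
        bounded_bilinear.FDERIV[OF br_bilinear] has_derivative_ident)
  from frechet_derivative_at[OF this, symmetric] show ?thesis
    by (simp add: left_field algebra_simps)
qed

end

section \<open>Chern-Rund connections along left invariant fields\<close>

text \<open>The connection depends on the Finsler metric only through the two tensors along the pole \<open>w\<close>;
  the last two assumptions say that these are left invariant, with coefficients \<open>g\<close> and \<open>C\<close>.
  \<open>C_pole\<close> reflects the homogeneity of the Finsler metric and makes the staged solution of the
  Koszul formula possible.\<close>

locale left_invariant_osculation = two_step_lie br + scalar_product g
  for br g :: "'a::euclidean_space \<Rightarrow> 'a \<Rightarrow> _" +
  fixes C :: "'a \<Rightarrow> 'a \<Rightarrow> 'a \<Rightarrow> real" and F :: "'a \<Rightarrow> 'a \<Rightarrow> real" and w :: 'a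
  assumes C_linear: "linear (\<lambda>u. C u v y)"
    and C_sym: "C u v y = C v u y" "C u v y = C u y v"
    and C_pole: "C w u v = 0"
    and osc: "osc F p (left_field br w p) (left_field br u p) (left_field br v p) = g u v"
    and cartan: "cartan F p (left_field br w p) (left_field br u p) (left_field br v p)
      (left_field br y p) = C u v y"
begin

lemma C_linears: "linear (\<lambda>v. C u v y)" "linear (\<lambda>y. C u v y)"
proof -
  show "linear (\<lambda>v. C u v y)" for u y
    using C_linear[of u y] by (simp add: C_sym(1)[of u])
  then show "linear (\<lambda>y. C u v y)"
    by (simp add: C_sym(2)[of u v])
qed

lemmas C_simps [simp] =
  linear_add[OF C_linear] linear_add[OF C_linears(1)] linear_add[OF C_linears(2)]
  linear_diff[OF C_linear] linear_diff[OF C_linears(1)] linear_diff[OF C_linears(2)]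
  linear_neg[OF C_linear] linear_neg[OF C_linears(1)] linear_neg[OF C_linears(2)]
  linear_cmul[OF C_linear] linear_cmul[OF C_linears(1)] linear_cmul[OF C_linears(2)]
  linear_0[OF C_linear] linear_0[OF C_linears(1)] linear_0[OF C_linears(2)]

lemma C_pole' [simp]: "C w u v = 0" "C u w v = 0" "C u v w = 0"
  using C_pole C_sym by metis+

text \<open>Torsion freeness and almost metricity for left invariant fields, with linearity left out on
  purpose: the restriction of an arbitrary Chern-Rund connection to left invariant fields satisfies
  these equations pointwise, and they already determine it.\<close>

definition christoffel :: "('a \<Rightarrow> 'a \<Rightarrow> 'a) \<Rightarrow> bool" where
  "christoffel n \<longleftrightarrow> (\<forall>x y. n x y - n y x = br x y) \<and>
     (\<forall>x y v. g (n x y) v + g y (n x v) + 2 * C (n x w) y v = 0)"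

text \<open>The usual cyclic combination of three instances of the almost metric equation.\<close>

lemma koszul:
  assumes "christoffel n"
  shows "2 * g (n x y) v = g (br x y) v - g (br y v) x + g (br v x) y
    - 2 * C (n x w) y v - 2 * C (n y w) v x + 2 * C (n v w) x y"
proof -
  have t: "br x y = n x y - n y x" for x y
    using assms by (simp add: christoffel_def)
  have m: "g (n x y) v + g y (n x v) + 2 * C (n x w) y v = 0" for x y v
    using assms by (simp add: christoffel_def)
  show ?thesis
    unfolding t using m[of x y v] m[of y v x] m[of v x y]
    by (simp add: sym[of y] sym[of v] sym[of x])
qed

text \<open>With the pole in one or two of the slots, \<open>C_pole\<close> removes the terms with products of the
  next stage.\<close>

lemma christoffel_pole:
  assumes "christoffel n"
  shows "2 * g (n w w) v = 2 * g (br v w) w"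
    and "2 * g (n x w) v = g (br x w) v - g (br w v) x + g (br v x) w - 2 * C (n w w) v x"
  using koszul[OF assms, of w w v] koszul[OF assms, of x w v] br_skew[of v w] by simp_all

lemma christoffel_unique:
  assumes n: "christoffel n" and m: "christoffel m"
  shows "n = m"
proof -
  have ww: "n w w = m w w"
    by (rule eqI) (use christoffel_pole(1)[OF n] christoffel_pole(1)[OF m] in simp)
  have w: "n x w = m x w" for x
  proof (rule eqI)
    fix v
    show "g (n x w) v = g (m x w) v"
      using christoffel_pole(2)[OF n, of x v] christoffel_pole(2)[OF m, of x v] ww
      by simp
  qed
  have "n x y = m x y" for x y
  proof (rule eqI)
    fix v
    show "g (n x y) v = g (m x y) v"
      using koszul[OF n, of x y v] koszul[OF m, of x y v] w by simp
  qed
  then show ?thesis by blast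
qed

text \<open>The three stages of the Koszul formula, each solved by the Riesz lemma: \<open>s\<close> is to be
  \<open>n w w\<close> and \<open>a x\<close> is to be \<open>n x w\<close>.  That \<open>n\<close> really takes these values is a consequence of
  \<open>C_pole\<close>, and only then do the defining equations of \<open>n\<close> become the almost metric equation.\<close>

lemma christoffel_exists:
  obtains n where "christoffel n" "bounded_bilinear n"
proof -
  obtain s where s: "g s v = g (br v w) w" for v
    by (rule riesz[of "\<lambda>v. g (br v w) w"]) (auto intro!: linearI)
  have "\<exists>a. \<forall>v. g a v = (g (br x w) v - g (br w v) x + g (br v x) w - 2 * C s v x) / 2" for x
    by (rule riesz[of "\<lambda>v. (g (br x w) v - g (br w v) x + g (br v x) w - 2 * C s v x) / 2"])
      (auto intro!: linearI simp: field_simps)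
  then obtain a where
    a: "g (a x) v = (g (br x w) v - g (br w v) x + g (br v x) w - 2 * C s v x) / 2" for x v
    by metis
  have a_lin: "linear a"
    by (rule linearI; rule eqI) (simp_all add: a field_simps)
  note a_simps = linear_add[OF a_lin] linear_cmul[OF a_lin]
  let ?K = "\<lambda>x y v. (g (br x y) v - g (br y v) x + g (br v x) y
      - 2 * C (a x) y v - 2 * C (a y) v x + 2 * C (a v) x y) / 2"
  have "\<exists>n. \<forall>v. g n v = ?K x y v" for x y
    by (rule riesz[of "?K x y"]) (auto intro!: linearI simp: a_simps field_simps)
  then obtain n where n: "g (n x y) v = ?K x y v" for x y v
    by metis
  have aw: "a w = s"
    by (rule eqI) (use br_skew[of _ w] in \<open>simp add: a s\<close>)
  have nw: "n x w = a x" for x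
    by (rule eqI) (simp add: n aw, simp add: a)
  have "christoffel n"
    unfolding christoffel_def
  proof (intro conjI allI)
    show "n x y - n y x = br x y" for x y
    proof (rule eqI)
      fix v
      show "g (n x y - n y x) v = g (br x y) v"
        using C_sym[of "a x"] C_sym[of "a y"] C_sym[of "a v"]
        by (simp add: n br_skew[of y x] br_skew[of v y] br_skew[of v x] field_simps)
    qed
    show "g (n x y) v + g y (n x v) + 2 * C (n x w) y v = 0" for x y v
      using C_sym(2)[of "a x" v y] C_sym(2)[of "a y" v x] C_sym(2)[of "a v" x y]
      by (simp add: sym[of y] n nw br_skew[of y x] br_skew[of v y] br_skew[of v x] field_simps)
  qed
  moreover have "bilinear n"
    unfolding bilinear_def
    by (intro conjI allI; rule linearI; rule eqI) (simp_all add: n a_simps field_simps)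
  ultimately show thesis
    using that by (simp add: bilinear_conv_bounded_bilinear)
qed

text \<open>In the left trivialization: the flat derivative plus the algebraic product.\<close>

definition connection :: "('a \<Rightarrow> 'a \<Rightarrow> 'a) \<Rightarrow> ('a \<Rightarrow> 'a) \<Rightarrow> ('a \<Rightarrow> 'a) \<Rightarrow> 'a \<Rightarrow> 'a" where
  "connection n X Y p =
     left_field br (frechet_derivative (triv Y) (at p) (X p) + n (triv X p) (triv Y p)) p"

lemma triv_add: "triv (\<lambda>p. X p + Y p) p = triv X p + triv Y p"
  and triv_scaleR: "triv (\<lambda>p. h p *\<^sub>R Y p) p = h p *\<^sub>R triv Y p"
  by (simp_all add: triv_def algebra_simps)

lemma affine_connection_connection:
  assumes "bounded_bilinear n"
  shows "affine_connection (connection n)"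
proof -
  interpret n: bounded_bilinear n by (rule assms)
  have lin: "linear (frechet_derivative (triv Y) (at p))" if "smooth Y" for Y p
    using smooth_has_derivative[OF smooth_triv[OF that]] has_derivative_linear by blast
  show ?thesis
    unfolding affine_connection_def
  proof (intro conjI allI impI)
    fix X Y :: "'a \<Rightarrow> 'a" assume "smooth X" "smooth Y"
    then show "smooth (connection n X Y)"
      unfolding connection_def[abs_def]
      by (intro smooth_left_field smooth_add smooth_field_deriv smooth_triv
          smooth_bilinear[OF assms])
  next
    fix X X' Y :: "'a \<Rightarrow> 'a" assume "smooth Y"
    then show "connection n (\<lambda>p. X p + X' p) Y = (\<lambda>p. connection n X Y p + connection n X' Y p)"
      by (intro ext)
        (simp add: connection_def triv_add linear_add[OF lin] n.add_left left_field_add)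
  next
    fix h :: "'a \<Rightarrow> real" and X Y :: "'a \<Rightarrow> 'a" assume "smooth Y"
    then show "connection n (\<lambda>p. h p *\<^sub>R X p) Y = (\<lambda>p. h p *\<^sub>R connection n X Y p)"
      by (intro ext)
        (simp add: connection_def triv_scaleR linear_cmul[OF lin] n.scaleR_left
          left_field_scaleR flip: scaleR_add_right)
  next
    fix X Y Y' :: "'a \<Rightarrow> 'a" assume Y: "smooth Y" "smooth Y'"
    have "frechet_derivative (triv (\<lambda>p. Y p + Y' p)) (at p) =
        (\<lambda>h. frechet_derivative (triv Y) (at p) h + frechet_derivative (triv Y') (at p) h)" for p
      unfolding triv_add
      by (rule frechet_derivative_at[symmetric], intro has_derivative_add smooth_has_derivative
          smooth_triv Y)
    then show "connection n X (\<lambda>p. Y p + Y' p) = (\<lambda>p. connection n X Y p + connection n X Y' p)"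
      by (intro ext) (simp add: connection_def triv_add n.add_right left_field_add)
  next
    fix h :: "'a \<Rightarrow> real" and X Y :: "'a \<Rightarrow> 'a" assume hY: "smooth h" "smooth Y"
    have "frechet_derivative (triv (\<lambda>p. h p *\<^sub>R Y p)) (at p) =
        (\<lambda>v. h p *\<^sub>R frechet_derivative (triv Y) (at p) v + frechet_derivative h (at p) v *\<^sub>R triv Y p)"
      for p
      unfolding triv_scaleR
      by (rule frechet_derivative_at[symmetric], intro has_derivative_scaleR smooth_has_derivative
          smooth_triv hY)
    then show "connection n X (\<lambda>p. h p *\<^sub>R Y p) =
        (\<lambda>p. field_deriv X h p *\<^sub>R Y p + h p *\<^sub>R connection n X Y p)"
      by (intro ext) (simp add: connection_def field_deriv_def triv_scaleR n.scaleR_right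
          left_field_add left_field_scaleR algebra_simps)
  qed
qed

lemma osc_triv: "osc F p (left_field br w p) (X p) (Y p) = g (triv X p) (triv Y p)"
  by (metis left_field_triv osc)

lemma cartan_triv:
  "cartan F p (left_field br w p) (X p) (Y p) (V p) = C (triv X p) (triv Y p) (triv V p)"
  by (metis left_field_triv cartan)

lemma triv_connection:
  "triv (connection n X Y) p = frechet_derivative (triv Y) (at p) (X p) + n (triv X p) (triv Y p)"
  by (simp add: connection_def triv_def[of "connection n X Y"] left_field)

lemma is_chern_rund_connection:
  assumes n: "christoffel n" and bil: "bounded_bilinear n"
  shows "is_chern_rund F (left_field br w) (connection n)"
  unfolding is_chern_rund_def
proof (intro conjI affine_connection_connection[OF bil])
  show "torsion_free (connection n)"
    unfolding torsion_free_def
  proof (intro allI impI ext)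
    fix X Y :: "'a \<Rightarrow> 'a" and p assume sm: "smooth X" "smooth Y"
    have "n (triv X p) (triv Y p) = n (triv Y p) (triv X p) + br (triv X p) (triv Y p)"
      using n by (metis christoffel_def diff_eq_eq add.commute)
    moreover have "br (triv X p) (triv Y p) = br (X p) (Y p)"
      by (simp add: triv_def)
    moreover have "left_field br (br u v) p = br u v" for u v
      by (simp add: left_field)
    moreover have "u - (1/2) *\<^sub>R u = (1/2) *\<^sub>R u" for u :: 'a
      by (simp add: diff_eq_eq flip: scaleR_add_left)
    ultimately show "connection n X Y p - connection n Y X p = field_bracket X Y p"
      by (simp add: connection_def left_field_add left_field_deriv_triv sm field_bracket_def
          field_deriv_def br_skew[of "Y p" "X p"])
  qed
  show "almost_metric F (left_field br w) (connection n)"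
    unfolding almost_metric_def
  proof (intro allI impI)
    fix X Y V :: "'a \<Rightarrow> 'a" and p assume sm: "smooth X" "smooth Y" "smooth V"
    have "((\<lambda>q. g (triv Y q) (triv V q)) has_derivative
        (\<lambda>h. g (triv Y p) (frechet_derivative (triv V) (at p) h)
           + g (frechet_derivative (triv Y) (at p) h) (triv V p))) (at p)"
      by (intro bounded_bilinear.FDERIV[OF bounded_bilinear] smooth_has_derivative smooth_triv sm)
    then have "field_deriv X (\<lambda>q. osc F q (left_field br w q) (Y q) (V q)) p =
        g (triv Y p) (frechet_derivative (triv V) (at p) (X p))
           + g (frechet_derivative (triv Y) (at p) (X p)) (triv V p)"
      unfolding osc_triv field_deriv_def by (simp add: frechet_derivative_at[symmetric])
    moreover have "g (n (triv X p) (triv Y p)) (triv V p) + g (triv Y p) (n (triv X p) (triv V p))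
        + 2 * C (n (triv X p) w) (triv Y p) (triv V p) = 0"
      using n by (simp add: christoffel_def)
    ultimately show "field_deriv X (\<lambda>q. osc F q (left_field br w q) (Y q) (V q)) p =
        osc F p (left_field br w p) (connection n X Y p) (V p)
        + osc F p (left_field br w p) (Y p) (connection n X V p)
        + 2 * cartan F p (left_field br w p) (connection n X (left_field br w) p) (Y p) (V p)"
      by (simp add: osc_triv cartan_triv triv_connection)
  qed
qed

text \<open>Osculating products of left invariant fields are constant, so the left hand side of the almost
  metric equation vanishes, and the values of the connection at a point \<open>p\<close>, pulled back to the
  Lie algebra, form a solution of \<open>christoffel\<close>.\<close>

lemma chern_rund_left_field:
  assumes n: "christoffel n"
  shows "chern_rund F (left_field br w) (left_field br x) (left_field br y) = left_field br (n x y)"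
proof
  fix p
  define nab where "nab = chern_rund F (left_field br w)"
  obtain m where "christoffel m" "bounded_bilinear m"
    by (rule christoffel_exists)
  then have nab: "is_chern_rund F (left_field br w) nab"
    unfolding nab_def chern_rund_def using is_chern_rund_connection by (metis someI)
  have "christoffel (\<lambda>x y. triv (nab (left_field br x) (left_field br y)) p)"
    unfolding christoffel_def
  proof (intro conjI allI)
    fix x y
    have "nab (left_field br x) (left_field br y) p - nab (left_field br y) (left_field br x) p
        = left_field br (br x y) p"
      using nab smooth_left_invariant field_bracket_left_field[OF lie nilpotent]
      unfolding is_chern_rund_def torsion_free_def by metis
    then have "left_field br (triv (nab (left_field br x) (left_field br y)) p
        - triv (nab (left_field br y) (left_field br x)) p) p = left_field br (br x y) p"
      by (simp add: left_field_diff)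
    then show "triv (nab (left_field br x) (left_field br y)) p
        - triv (nab (left_field br y) (left_field br x)) p = br x y"
      by (metis triv_left_field triv_def)
  next
    fix x y v
    have "field_deriv (left_field br x) (\<lambda>q. osc F q (left_field br w q) (left_field br y q)
          (left_field br v q)) p = 0"
      by (simp add: osc field_deriv_def frechet_derivative_const)
    moreover have "field_deriv (left_field br x) (\<lambda>q. osc F q (left_field br w q)
          (left_field br y q) (left_field br v q)) p =
        osc F p (left_field br w p) (nab (left_field br x) (left_field br y) p) (left_field br v p)
        + osc F p (left_field br w p) (left_field br y p) (nab (left_field br x) (left_field br v) p)
        + 2 * cartan F p (left_field br w p) (nab (left_field br x) (left_field br w) p)
            (left_field br y p) (left_field br v p)"
      using nab smooth_left_invariant unfolding is_chern_rund_def almost_metric_def by blast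
    ultimately show "g (triv (nab (left_field br x) (left_field br y)) p) v
        + g y (triv (nab (left_field br x) (left_field br v)) p)
        + 2 * C (triv (nab (left_field br x) (left_field br w)) p) y v = 0"
      by (simp add: osc_triv cartan_triv)
  qed
  then have "n = (\<lambda>x y. triv (nab (left_field br x) (left_field br y)) p)"
    by (rule christoffel_unique[OF n])
  then show "nab (left_field br x) (left_field br y) p = left_field br (n x y) p"
    by simp
qed

text \<open>The curvature involves \<open>n x (n w w)\<close> and \<open>n w (n x w)\<close>.  Torsion freeness turns the
  first into \<open>n (n w w) x\<close> plus a bracket, and the product of the former with \<open>x\<close> is a value of \<open>C\<close> by almost metricity; for
  the second, almost metricity moves the outer derivative to \<open>x\<close>, where \<open>n w x\<close> differs from
  \<open>n x w\<close> by a bracket.\<close>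

lemma flag_curvature_left_field:
  assumes n: "christoffel n"
  defines "A \<equiv> \<lambda>x. n x w"
  shows "flag_curvature br F w x =
    (g (A x) (A x) - g (A x) (br x w) - g (A (br x w)) x + 2 * C (A w) (A x) x
       - g (br (A w) x) x - C (A (A w)) x x) / (g w w * g x x - (g x w)\<^sup>2)"
proof -
  have t: "n x y = n y x + br x y" for x y
    using n by (metis christoffel_def diff_eq_eq add.commute)
  have m: "g (n x y) v + g y (n x v) + 2 * C (n x w) y v = 0" for x y v
    using n by (simp add: christoffel_def)
  have at0: "left_field br v 0 = v" for v
    by (simp add: left_field)
  have osc0: "osc F 0 w u v = g u v" for u v
    using osc[of 0 u v] by (simp add: at0)
  have "curvature (chern_rund F (left_field br w)) (left_field br x) (left_field br w)
      (left_field br w) 0 = n x (n w w) - n w (n x w) - n (br x w) w"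
    by (simp add: curvature_def field_bracket_left_field[OF lie nilpotent]
        chern_rund_left_field[OF n] at0)
  moreover have "g (n x (n w w)) x = - g (br (A w) x) x - C (A (A w)) x x"
    using t[of x "n w w"] m[of "n w w" x x] br_skew[of x "n w w"] sym[of x]
    by (simp add: A_def)
  moreover have "g (n w (n x w)) x = - g (A x) (A x) + g (A x) (br x w) - 2 * C (A w) (A x) x"
    using t[of w x] m[of w "n x w" x] br_skew[of w x]
    by (simp add: A_def)
  ultimately show ?thesis
    by (simp add: flag_curvature_def osc0 A_def Let_def)
qed

end

section \<open>Osculating product and Cartan tensor of a Randers functional\<close>

locale randers = scalar_product B for B :: "'a::euclidean_space \<Rightarrow> 'a \<Rightarrow> real" +
  fixes \<beta> :: "'a \<Rightarrow> real"
  assumes \<beta>_linear: "linear \<beta>"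
begin

lemmas \<beta>_simps [simp] =
  linear_add[OF \<beta>_linear] linear_diff[OF \<beta>_linear] linear_neg[OF \<beta>_linear]
  linear_cmul[OF \<beta>_linear] linear_0[OF \<beta>_linear]

definition len :: "'a \<Rightarrow> real" where
  "len v = sqrt (B v v)"

lemma len_pos: "v \<noteq> 0 \<Longrightarrow> len v > 0"
  by (simp add: len_def pos)

lemma deriv_len:
  assumes "m \<noteq> 0"
  shows "((\<lambda>t. len (m + t *\<^sub>R v)) has_real_derivative B m v / len m) (at 0)"
  unfolding len_def using pos[OF assms]
  by (auto intro!: derivative_eq_intros simp: sym[of v m] field_simps)

abbreviation Q :: "'a \<Rightarrow> real" where
  "Q v \<equiv> (len v + \<beta> v)\<^sup>2"

text \<open>The derivatives of \<open>Q\<close> at \<open>m\<close> in the direction \<open>v\<close>, and, for \<open>D2\<close>, in the directions \<open>u\<close> and \<open>v\<close>.\<close>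

definition D1 :: "'a \<Rightarrow> 'a \<Rightarrow> real" where
  "D1 m v = 2 * (len m + \<beta> m) * (B m v / len m + \<beta> v)"

definition D2 :: "'a \<Rightarrow> 'a \<Rightarrow> 'a \<Rightarrow> real" where
  "D2 m u v = 2 * (B m u / len m + \<beta> u) * (B m v / len m + \<beta> v)
     + 2 * (len m + \<beta> m) * (B u v / len m - B m u * B m v / len m ^ 3)"

lemma deriv_Q: "m \<noteq> 0 \<Longrightarrow> deriv (\<lambda>t. Q (m + t *\<^sub>R v)) 0 = D1 m v"
  by (rule DERIV_imp_deriv) (auto intro!: derivative_eq_intros deriv_len simp: D1_def)

lemma deriv_D1:
  assumes "m \<noteq> 0"
  shows "deriv (\<lambda>s. D1 (m + s *\<^sub>R u) v) 0 = D2 m u v"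
proof (rule DERIV_imp_deriv)
  have "((\<lambda>s. 2 * (len (m + s *\<^sub>R u) + (\<beta> m + s * \<beta> u)) * ((B m v + s * B u v) / len (m + s *\<^sub>R u) + \<beta> v))
      has_real_derivative D2 m u v) (at 0)"
    using len_pos[OF assms]
    by (auto intro!: derivative_eq_intros deriv_len assms simp: D2_def field_simps power3_eq_cube)
  then show "((\<lambda>s. D1 (m + s *\<^sub>R u) v) has_real_derivative D2 m u v) (at 0)"
    by (simp add: D1_def)
qed

lemma eventually_line_nonzero:
  fixes w u :: 'a
  assumes "w \<noteq> 0"
  shows "\<forall>\<^sub>F s in nhds 0. w + s *\<^sub>R u \<noteq> 0"
proof (rule tendsto_imp_eventually_ne)
  show "((\<lambda>s. w + s *\<^sub>R u) \<longlongrightarrow> w) (nhds 0)"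
    by (auto intro!: tendsto_eq_intros filterlim_ident)
qed (rule assms)

text \<open>The inner derivative has its closed form only where the base point is nonzero, which holds near
  the origin of the outer parameter.\<close>

lemma deriv_deriv_Q:
  assumes "w \<noteq> 0"
  shows "deriv (\<lambda>s. deriv (\<lambda>t. Q (w + s *\<^sub>R u + t *\<^sub>R v)) 0) 0 = D2 w u v"
proof -
  have "deriv (\<lambda>s. deriv (\<lambda>t. Q (w + s *\<^sub>R u + t *\<^sub>R v)) 0) 0 = deriv (\<lambda>s. D1 (w + s *\<^sub>R u) v) 0"
    by (rule deriv_cong_ev[OF _ refl], rule eventually_mono[OF eventually_line_nonzero[OF assms]])
      (rule deriv_Q)
  then show ?thesis
    by (simp add: deriv_D1 assms)
qed

text \<open>At a unit vector \<open>w\<close> this is the Hessian of the norm.\<close>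

definition angular :: "'a \<Rightarrow> 'a \<Rightarrow> 'a \<Rightarrow> real" where
  "angular w u v = B u v - B w u * B w v"

definition osc_form :: "'a \<Rightarrow> 'a \<Rightarrow> 'a \<Rightarrow> real" where
  "osc_form w u v = (\<beta> u + B w u) * (\<beta> v + B w v) + (1 + \<beta> w) * angular w u v"

text \<open>The Cartan tensor comes only from the mixed term \<open>2 len \<beta>\<close> of \<open>Q\<close>.  Its third derivative at a unit
  vector is the cyclic sum of the angular form against \<open>\<beta> - \<beta> w * B w\<close>, a functional that
  vanishes at \<open>w\<close>, and identically if \<open>\<beta>\<close> is a multiple of \<open>B w\<close>.\<close>

definition cartan_form :: "'a \<Rightarrow> 'a \<Rightarrow> 'a \<Rightarrow> 'a \<Rightarrow> real" where
  "cartan_form w u v y =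
     ((\<beta> u - \<beta> w * B w u) * angular w v y + (\<beta> v - \<beta> w * B w v) * angular w u y
        + (\<beta> y - \<beta> w * B w y) * angular w u v) / 2"

context
  fixes w :: 'a
  assumes unit: "B w w = 1"
begin

lemma len_unit: "len w = 1" and unit_nonzero: "w \<noteq> 0"
  using unit by (auto simp: len_def)

lemma osc_Q: "1/2 * deriv (\<lambda>s. deriv (\<lambda>t. Q (w + s *\<^sub>R u + t *\<^sub>R v)) 0) 0 = osc_form w u v"
  unfolding deriv_deriv_Q[OF unit_nonzero]
  by (simp add: D2_def len_unit osc_form_def angular_def field_simps)

lemma deriv_D2: "deriv (\<lambda>r. D2 (w + r *\<^sub>R u) v y) 0 = 4 * cartan_form w u v y"
proof (rule DERIV_imp_deriv)
  have "((\<lambda>r. 2 * ((B w v + r * B u v) / len (w + r *\<^sub>R u) + \<beta> v) * ((B w y + r * B u y) / len (w + r *\<^sub>R u) + \<beta> y)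
     + 2 * (len (w + r *\<^sub>R u) + (\<beta> w + r * \<beta> u)) * (B v y / len (w + r *\<^sub>R u)
       - (B w v + r * B u v) * (B w y + r * B u y) / len (w + r *\<^sub>R u) ^ 3))
      has_real_derivative 4 * cartan_form w u v y) (at 0)"
    by (rule derivative_eq_intros deriv_len unit_nonzero refl | simp add: len_unit)+
      (simp add: cartan_form_def angular_def field_simps)
  then show "((\<lambda>r. D2 (w + r *\<^sub>R u) v y) has_real_derivative 4 * cartan_form w u v y) (at 0)"
    by (simp add: D2_def)
qed

lemma cartan_Q:
  "1/4 * deriv (\<lambda>r. deriv (\<lambda>s. deriv (\<lambda>t. Q (w + r *\<^sub>R u + s *\<^sub>R v + t *\<^sub>R y)) 0) 0) 0
     = cartan_form w u v y"
proof -
  have "deriv (\<lambda>r. deriv (\<lambda>s. deriv (\<lambda>t. Q (w + r *\<^sub>R u + s *\<^sub>R v + t *\<^sub>R y)) 0) 0) 0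
      = deriv (\<lambda>r. D2 (w + r *\<^sub>R u) v y) 0"
    by (rule deriv_cong_ev[OF _ refl],
        rule eventually_mono[OF eventually_line_nonzero[OF unit_nonzero]]) (rule deriv_deriv_Q)
  then show ?thesis
    by (simp add: deriv_D2)
qed

text \<open>The angular part is positive on every vector that is not a multiple of \<open>w\<close>, and the square
  is positive on the nonzero multiples.\<close>

lemma osc_form_scalar_product:
  assumes "1 + \<beta> w > 0"
  shows "euclidean_scalar_product (osc_form w)"
  unfolding euclidean_scalar_product_def
proof (intro conjI allI impI)
  show "linear (osc_form w u)" for u
    by (rule linearI) (simp_all add: osc_form_def angular_def algebra_simps)
  show "osc_form w u v = osc_form w v u" for u v
    by (simp add: osc_form_def angular_def sym[of u v])
  fix v :: 'a assume "v \<noteq> 0"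
  let ?q = "v - B w v *\<^sub>R w"
  have ang: "angular w v v = B ?q ?q"
    by (simp add: angular_def unit sym[of v w])
  show "osc_form w v v > 0"
  proof (cases "?q = 0")
    case True
    then have v: "v = B w v *\<^sub>R w" by simp
    then have "B w v \<noteq> 0" using \<open>v \<noteq> 0\<close> by (metis scaleR_zero_left)
    moreover have "\<beta> v = B w v * \<beta> w" by (subst v) simp
    then have "\<beta> v + B w v = B w v * (1 + \<beta> w)"
      by (simp add: algebra_simps)
    ultimately have "\<beta> v + B w v \<noteq> 0" using assms by simp
    then have "(\<beta> v + B w v) * (\<beta> v + B w v) > 0"
      using not_real_square_gt_zero by blast
    then show ?thesis
      using True unfolding osc_form_def ang by simp
  next
    case False
    have "(1 + \<beta> w) * B ?q ?q > 0"
      by (rule mult_pos_pos[OF assms pos[OF False]])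
    then show ?thesis
      unfolding osc_form_def ang by (rule add_nonneg_pos[OF zero_le_square])
  qed
qed

end

end

section \<open>Flag curvatures of a Z-Randers metric\<close>

lemma is_flag_orthogonal:
  assumes "scalar_product B" "x \<noteq> 0" "y \<noteq> 0" "B x y = 0"
  shows "is_flag x y"
proof -
  interpret scalar_product B by fact
  have "x \<noteq> k *\<^sub>R y" for k
  proof
    assume "x = k *\<^sub>R y"
    then have "B x x = k * B x y" by simp
    then show False
      using assms(2,4) pos[of x] by simp
  qed
  then have "x \<notin> span {y}" by (auto simp: span_singleton)
  moreover have "x \<noteq> y"
    using assms self_eq_0_iff by auto
  ultimately show ?thesis
    using assms(3) by (simp add: is_flag_def independent_insert)
qed

locale z_randers = two_step_lie br + scalar_product ip
  for br ip :: "'a::euclidean_space \<Rightarrow> 'a \<Rightarrow> _" +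
  fixes Z :: 'a and \<xi> :: real
  assumes center: "lie_center br = span {Z}"
    and unit: "ip Z Z = 1"
    and \<xi>: "0 < \<xi>" "\<xi> < 1"
begin

abbreviation F :: "'a \<Rightarrow> 'a \<Rightarrow> real" where
  "F \<equiv> left_invariant_metric br (randers_functional ip (\<xi> *\<^sub>R Z))"

sublocale randers ip "\<lambda>v. \<xi> * ip Z v"
  by unfold_locales (auto intro!: linearI simp: algebra_simps)

lemma F_left_field: "F p (left_field br v p) = len v + \<xi> * ip Z v"
proof -
  have "(group_mult br (- p) has_derivative (\<lambda>h. h + (1/2) *\<^sub>R br (- p) h)) (at p)"
    unfolding group_mult_def
    by (auto intro!: derivative_eq_intros bounded_bilinear.bounded_linear_right[OF br_bilinear]
        bounded_linear_imp_has_derivative simp del: br_simps)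
  from frechet_derivative_at[OF this, symmetric]
  have "F p (left_field br v p) = randers_functional ip (\<xi> *\<^sub>R Z) (triv (left_field br v) p)"
    by (simp add: left_invariant_metric_def triv_def del: triv_left_field)
  then show ?thesis
    by (simp add: randers_functional_def len_def)
qed

lemma osculation:
  assumes "ip w w = 1" "1 + \<xi> * ip Z w > 0"
  shows "left_invariant_osculation br (osc_form w) (cartan_form w) F w"
proof (intro left_invariant_osculation.intro left_invariant_osculation_axioms.intro
    scalar_product.intro two_step_lie_axioms)
  show "euclidean_scalar_product (osc_form w)"
    using osc_form_scalar_product assms by simp
  show "linear (\<lambda>u. cartan_form w u v y)" for v y
    by (rule linearI) (simp_all add: cartan_form_def angular_def field_simps)
  show "cartan_form w u v y = cartan_form w v u y" "cartan_form w u v y = cartan_form w u y v"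
    for u v y
    by (simp_all add: cartan_form_def angular_def sym[of u v] sym[of y v] sym[of u y] algebra_simps)
  show "cartan_form w w u v = 0" for u v
    by (simp add: cartan_form_def angular_def assms)
  show "osc F p (left_field br w p) (left_field br u p) (left_field br v p) = osc_form w u v" for p u v
    unfolding osc_def osc_Q[OF assms(1), symmetric]
    by (simp only: F_left_field flip: left_field_add left_field_scaleR)
  show "cartan F p (left_field br w p) (left_field br u p) (left_field br v p) (left_field br y p)
      = cartan_form w u v y" for p u v y
    unfolding cartan_def cartan_Q[OF assms(1), symmetric]
    by (simp only: F_left_field flip: left_field_add left_field_scaleR)
qed

text \<open>The symplectic form of the Heisenberg algebra, extended by zero on the center.\<close>

definition \<kappa> :: "'a \<Rightarrow> 'a \<Rightarrow> real" where
  "\<kappa> u v = ip Z (br u v)"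

lemma br_\<kappa>: "br u v = \<kappa> u v *\<^sub>R Z"
proof -
  have "br u v \<in> lie_center br"
    by (simp add: lie_center_def)
  then obtain k where "br u v = k *\<^sub>R Z"
    by (auto simp: center span_singleton)
  then show ?thesis
    by (simp add: \<kappa>_def unit)
qed

lemma br_Z [simp]: "br Z v = 0" "br v Z = 0"
proof -
  show "br Z v = 0"
    using center span_base[of Z "{Z}"] by (auto simp: lie_center_def)
  then show "br v Z = 0"
    by (subst br_skew) simp
qed

text \<open>Gram-Schmidt starting with \<open>Z\<close>, applied to a noncommuting pair: neither subtracting central
  parts nor subtracting a multiple of the first vector from the second changes the bracket.\<close>

lemma horizontal_pair:
  obtains e f where "ip e e = 1" "ip f f = 1" "ip e f = 0" "ip Z e = 0" "ip Z f = 0" "\<kappa> e f \<noteq> 0"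
proof -
  define normalize where "normalize v = (1 / sqrt (ip v v)) *\<^sub>R v" for v
  have normalize: "ip (normalize v) (normalize v) = 1" if "v \<noteq> 0" for v
    using pos[OF that] by (simp add: normalize_def)
  obtain x y where xy: "br x y \<noteq> 0"
    using nilpotent by (auto simp: two_step_nilpotent_def)
  define x' where "x' = x - ip Z x *\<^sub>R Z"
  define y' where "y' = y - ip Z y *\<^sub>R Z"
  have x': "br x' y' \<noteq> 0" "ip Z x' = 0" "ip Z y' = 0"
    using xy by (simp_all add: x'_def y'_def unit)
  then have x0: "x' \<noteq> 0" by auto
  define e where "e = normalize x'"
  have e: "ip e e = 1" "ip Z e = 0" "br e y' \<noteq> 0"
    using x' normalize[OF x0] pos[OF x0] by (auto simp: e_def) (auto simp: normalize_def)
  define y'' where "y'' = y' - ip e y' *\<^sub>R e"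
  have y'': "ip e y'' = 0" "ip Z y'' = 0" "br e y'' \<noteq> 0"
    using e x' by (simp_all add: y''_def)
  then have y0: "y'' \<noteq> 0" by auto
  define f where "f = normalize y''"
  have f: "ip f f = 1" "ip Z f = 0" "ip e f = 0" "br e f \<noteq> 0"
    using y'' normalize[OF y0] pos[OF y0] by (auto simp: f_def) (auto simp: normalize_def)
  then have "\<kappa> e f \<noteq> 0"
    using br_\<kappa>[of e f] by auto
  then show thesis
    using that e f by blast
qed

text \<open>Here \<open>\<beta>\<close> is a multiple of the product with the pole, so the Cartan tensor vanishes and the connection
  is the Levi-Civita connection of the osculating product.  As the pole is central and
  \<open>A Z = 0\<close>, the numerator reduces to the squared length of \<open>A e\<close>.\<close>

lemma flag_curvature_center_pos:
  assumes e: "ip e e = 1" "ip Z e = 0" and noncentral: "\<kappa> e f \<noteq> 0"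
  shows "flag_curvature br F Z e > 0"
proof -
  interpret O: left_invariant_osculation br "osc_form Z" "cartan_form Z" F Z
    by (rule osculation) (use unit \<xi> in simp_all)
  obtain n where n: "O.christoffel n"
    using O.christoffel_exists by blast
  have C0: "cartan_form Z u v y = 0" for u v y
    by (simp add: cartan_form_def unit)
  have A: "2 * osc_form Z (n x Z) v = osc_form Z (br v x) Z" for x v
    using O.koszul[OF n, of x Z v] by (simp add: C0)
  have "n Z Z = 0"
    by (rule O.eqI) (use A[of Z] in simp)
  moreover have "n 0 Z = 0"
    by (rule O.eqI) (use A[of 0] in simp)
  moreover have "osc_form Z (n e Z) (n e Z) > 0"
  proof (rule O.pos)
    have "osc_form Z (br f e) Z = \<kappa> f e * (1 + \<xi>)\<^sup>2"
      by (subst br_\<kappa>) (simp add: osc_form_def angular_def unit power2_eq_square algebra_simps)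
    moreover have "\<kappa> f e \<noteq> 0"
      using noncentral by (simp add: \<kappa>_def br_skew[of f e])
    ultimately show "n e Z \<noteq> 0"
      using A[of e f] \<xi> by auto
  qed
  moreover have "osc_form Z e Z = 0"
    by (simp add: osc_form_def angular_def e unit sym[of e Z])
  moreover have "osc_form Z Z Z > 0" "osc_form Z e e > 0"
    using e unit by (auto intro!: O.pos)
  ultimately show ?thesis
    by (simp add: O.flag_curvature_left_field[OF n] C0)
qed

text \<open>The deformation enters
  through the products of \<open>Z\<close> with \<open>e\<close> in \<open>g\<close> and through the Cartan tensor, and makes
  the pole nongeodesic, since \<open>n e e = - \<xi> Je\<close>.  The remaining vectors are found by comparing products
  with all \<open>v\<close>; of \<open>A (A e)\<close> only the component along \<open>Z\<close> is seen by the Cartan tensor.\<close>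

lemma flag_curvature_horizontal_neg:
  assumes e: "ip e e = 1" "ip Z e = 0" and f: "ip f f = 1" "ip Z f = 0" and ef: "ip e f = 0"
    and noncentral: "\<kappa> e f \<noteq> 0"
    and Je: "\<And>v. ip Je v = \<kappa> e v" and Jf: "\<And>v. ip Jf v = \<kappa> f v"
    and le: "ip Jf Jf \<le> ip Je Je"
  shows "flag_curvature br F e f < 0"
proof -
  interpret O: left_invariant_osculation br "osc_form e" "cartan_form e" F e
    by (rule osculation) (use e in simp_all)
  obtain n where n: "O.christoffel n"
    using O.christoffel_exists by blast
  have fe: "ip f e = 0" and eZ: "ip e Z = 0" and fZ: "ip f Z = 0"
    using ef e f sym by metis+
  have \<kappa>_skew: "\<kappa> u v = - \<kappa> v u" for u v
    by (simp add: \<kappa>_def br_skew[of u v])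
  have \<kappa>_self: "\<kappa> u u = 0" and \<kappa>_Z: "\<kappa> u Z = 0" for u
    by (simp_all add: \<kappa>_def)
  have Je_simps: "ip Z Je = 0" "ip e Je = 0" "ip Je f = \<kappa> e f" "ip f Je = \<kappa> e f"
    using Je \<kappa>_self \<kappa>_Z sym by metis+
  have Jf_simps: "ip Z Jf = 0" "ip f Jf = 0" "ip Jf f = 0" "ip e Jf = - \<kappa> e f"
    "ip Jf Z = 0" "ip Jf e = - \<kappa> e f"
    using Jf \<kappa>_self \<kappa>_Z sym \<kappa>_skew by metis+
  note basic = e f ef fe eZ fZ unit Je_simps Jf_simps
  let ?g = "osc_form e" and ?C = "cartan_form e" and ?c = "\<kappa> e f"
  have g: "?g u v = (\<xi> * ip Z u + ip e u) * (\<xi> * ip Z v + ip e v) + ip u v - ip e u * ip e v" for u v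
    by (simp add: osc_form_def angular_def e)
  have C: "2 * ?C u v y = \<xi> * (ip Z u * (ip v y - ip e v * ip e y)
      + ip Z v * (ip u y - ip e u * ip e y) + ip Z y * (ip u v - ip e u * ip e v))" for u v y
    by (simp add: cartan_form_def angular_def e field_simps)
  have s: "n e e = - \<xi> *\<^sub>R Je"
  proof (rule O.eqI)
    fix v
    have "?g (n e e) v = \<kappa> v e * ?g Z e"
      using O.christoffel_pole(1)[OF n, of v] by (simp add: br_\<kappa>[of v e])
    then show "?g (n e e) v = ?g (- \<xi> *\<^sub>R Je) v"
      by (simp add: g basic Je \<kappa>_skew[of v e])
  qed
  have a: "n f e = (- 1 / 2) *\<^sub>R (?c *\<^sub>R Z + \<xi> *\<^sub>R Jf)"
  proof (rule O.eqI)
    fix v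
    have "2 * ?g (n f e) v = - ?c * ?g Z v + \<kappa> v f * ?g Z e - \<kappa> e v * ?g Z f
        + \<xi> * (2 * ?C Je v f)"
      using O.christoffel_pole(2)[OF n, of f v] s
      by (simp add: br_\<kappa>[of v f] br_\<kappa>[of e v] br_\<kappa>[of f e] \<kappa>_skew[of f e])
    then show "?g (n f e) v = ?g ((- 1 / 2) *\<^sub>R (?c *\<^sub>R Z + \<xi> *\<^sub>R Jf)) v"
      unfolding C by (simp add: g basic Jf \<kappa>_skew[of v f] algebra_simps)
  qed
  have z: "?g (n (br f e) e) f = ?c\<^sup>2 / 2"
  proof -
    have "2 * ?g (n (br f e) e) f = ?c * (?c * ?g Z Z) - \<xi> * ?c * (2 * ?C Je f Z)"
      using O.christoffel_pole(2)[OF n, of "br f e" f] s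
      by (simp add: br_\<kappa>[of e f] br_\<kappa>[of f e] \<kappa>_skew[of f e])
    then show ?thesis
      unfolding C by (simp add: g basic power2_eq_square algebra_simps)
  qed
  have ss: "?C (n (n e e) e) f f = \<xi>\<^sup>2 * ip Je Je / 4"
  proof -
    let ?u = "n (n e e) e"
    have je: "\<kappa> Je e = - ip Je Je"
      by (simp add: Je \<kappa>_skew[of Je])
    have "2 * ?g ?u Z = \<xi> * ip Je Je * ?g Z Z - \<xi>\<^sup>2 * (2 * ?C Je Z Je)"
      using O.christoffel_pole(2)[OF n, of "n e e" Z] s
      by (simp add: br_\<kappa>[of Je e] je power2_eq_square)
    then have uZ: "2 * ?g ?u Z = \<xi> * ip Je Je"
      unfolding C by (simp add: g basic power2_eq_square algebra_simps)
    have ue: "?g ?u e = 0"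
      using O.christoffel_pole(2)[OF n, of "n e e" e] br_skew[of "n e e" e] by simp
    \<comment> \<open>The form \<open>g\<close> mixes the directions \<open>Z\<close> and \<open>e\<close>; this combination isolates \<open>ip Z\<close>.\<close>
    have "ip Z ?u = ?g ?u Z - \<xi> * ?g ?u e"
      by (simp add: g basic sym[of ?u] algebra_simps)
    then have "ip Z ?u = \<xi> * ip Je Je / 2"
      using uZ ue by simp
    then have "2 * ?C ?u f f = \<xi>\<^sup>2 * ip Je Je / 2"
      unfolding C by (simp add: basic power2_eq_square)
    then show ?thesis by simp
  qed
  have t1: "?g (n f e) (n f e) = (?c\<^sup>2 + \<xi>\<^sup>2 * (ip Jf Jf - ?c\<^sup>2)) / 4"
    by (simp add: a g basic power2_eq_square field_simps)
  have t2: "?g (n f e) (br f e) = ?c\<^sup>2 / 2"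
    by (simp add: a g basic br_\<kappa>[of f e] \<kappa>_skew[of f e] power2_eq_square field_simps)
  have t3: "2 * ?C (n e e) (n f e) f = \<xi>\<^sup>2 * ?c\<^sup>2 / 2"
    unfolding C by (simp add: s a basic power2_eq_square field_simps)
  have t4: "?g (br (n e e) f) f = 0"
    by (simp add: br_\<kappa>[of "n e e" f] g basic)
  have t5: "?g e e = 1" "?g f f = 1" "?g f e = 0"
    by (simp_all add: g basic)
  have "flag_curvature br F e f =
      ((?c\<^sup>2 + \<xi>\<^sup>2 * (ip Jf Jf - ?c\<^sup>2)) / 4 - ?c\<^sup>2 / 2 - ?c\<^sup>2 / 2 + \<xi>\<^sup>2 * ?c\<^sup>2 / 2 - \<xi>\<^sup>2 * ip Je Je / 4)"
    unfolding O.flag_curvature_left_field[OF n] z ss t1 t2 t3 t4 t5 by simp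
  also have "\<dots> = (\<xi>\<^sup>2 - 3) * ?c\<^sup>2 / 4 - \<xi>\<^sup>2 * (ip Je Je - ip Jf Jf) / 4"
    by (simp add: field_simps)
  also have "\<dots> < 0"
  proof -
    have "\<xi>\<^sup>2 < 1"
      using \<xi> by (simp add: power_less_one_iff)
    then have "(\<xi>\<^sup>2 - 3) * ?c\<^sup>2 < 0"
      using noncentral by (intro mult_neg_pos) auto
    moreover have "\<xi>\<^sup>2 * (ip Je Je - ip Jf Jf) \<ge> 0"
      using le by simp
    ultimately show ?thesis by linarith
  qed
  finally show ?thesis .
qed

lemma flag_curvature_signs:
  shows "\<exists>W X. is_flag W X \<and> flag_curvature br F W X < 0"
    and "\<exists>W X. is_flag W X \<and> flag_curvature br F W X > 0"
proof -
  obtain e f where e: "ip e e = 1" "ip Z e = 0" and f: "ip f f = 1" "ip Z f = 0"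
    and ef: "ip e f = 0" "\<kappa> e f \<noteq> 0"
    by (rule horizontal_pair)
  have fe: "ip f e = 0" "\<kappa> f e \<noteq> 0"
    using ef sym[of e f] by (auto simp: \<kappa>_def br_skew[of f e])
  have nz: "Z \<noteq> 0" "e \<noteq> 0" "f \<noteq> 0"
    using e f unit by auto
  have flag: "is_flag x y" if "x \<noteq> 0" "y \<noteq> 0" "ip x y = 0" for x y
    using is_flag_orthogonal[of ip] that scalar_product_axioms by blast
  have \<kappa>_linear: "linear (\<kappa> u)" for u
    by (rule linearI) (simp_all add: \<kappa>_def)
  obtain Je where Je: "\<And>v. ip Je v = \<kappa> e v"
    using riesz[OF \<kappa>_linear[of e]] by blast
  obtain Jf where Jf: "\<And>v. ip Jf v = \<kappa> f v"
    using riesz[OF \<kappa>_linear[of f]] by blast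
  show "\<exists>W X. is_flag W X \<and> flag_curvature br F W X < 0"
  \<comment> \<open>Of the two orders of the pair, the pole is the vector with the longer image under \<open>J\<close>.\<close>
  proof (cases "ip Jf Jf \<le> ip Je Je")
    case True
    then have "flag_curvature br F e f < 0"
      by (intro flag_curvature_horizontal_neg[OF e f ef Je Jf])
    then show ?thesis
      using flag[OF nz(2,3) ef(1)] by blast
  next
    case False
    then have "flag_curvature br F f e < 0"
      by (intro flag_curvature_horizontal_neg[OF f e fe Jf Je]) simp
    then show ?thesis
      using flag[OF nz(3,2) fe(1)] by blast
  qed
  show "\<exists>W X. is_flag W X \<and> flag_curvature br F W X > 0"
    by (intro exI[of _ Z] exI[of _ e] conjI flag_curvature_center_pos[OF e ef(2)] flag nz e(2))
qed

end

theorem mainTheorem1: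
  fixes br :: "'a::euclidean_space \<Rightarrow> 'a \<Rightarrow> 'a"
    and ip :: "'a \<Rightarrow> 'a \<Rightarrow> real"
    and Z X0 :: 'a
    and \<xi> :: real
    and F :: "'a \<Rightarrow> 'a \<Rightarrow> real"
  assumes "heisenberg_algebra5 br"
    and "euclidean_scalar_product ip"
    and "lie_center br = span {Z}"
    and "ip Z Z = 1"
    and "0 < \<xi>" and "\<xi> < 1"
    and "X0 = \<xi> *\<^sub>R Z"
    and "F = left_invariant_metric br (randers_functional ip X0)"
  shows "(\<exists>W X. is_flag W X \<and> flag_curvature br F W X < 0) \<and>
         (\<exists>W X. is_flag W X \<and> flag_curvature br F W X > 0)"
proof -
  interpret z_randers br ip Z \<xi>
    by unfold_locales (use assms(1-6) in \<open>simp_all add: heisenberg_algebra5_def\<close>)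
  show ?thesis
    unfolding assms(7,8) using flag_curvature_signs by (rule conjI)
qed

end
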